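(* Let $a\in\{1,3\}$. Then the sequence $$A(n)=\sum_{k=0}^n(-1)^k\binom{n}{k}^a\binom{4n-5k}{3n}\qquad(n\ge0)$$ satisfies the Lucas congruences: for every prime $p$ and every $n\ge0$ with base-$p$ expansion $n=n_0+n_1p+\cdots+n_rp^r$, $A(n)\equiv A(n_0)A(n_1)\cdots A(n_r)\pmod p$.
   Context: For integers $m\ge0$ and any number $x$, $\binom{x}{m}=\frac{x(x-1)\cdots(x-m+1)}{m!}$ (so the upper entry $4n-5k$ may be negative). *)

theory Defs
  imports Complex_Main "HOL-Number_Theory.Cong" "HOL-Computational_Algebra.Primes"
begin

text \<open>
  The binomial coefficient with integer (possibly negative) upper entry. This is the defining
  formula of \<open>gchoose\<close> at type \<open>int\<close>, where the library's sort constraint on \<open>gchoose\<close> prevents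
  writing it directly. The division is exact, as \<open>fact_mult_zbinom\<close> shows.
\<close>

definition zbinom :: "int \<Rightarrow> nat \<Rightarrow> int" where
  "zbinom x m = (\<Prod>i=0..<m. x - int i) div fact m"

lemma fact_mult_zbinom: "fact m * zbinom x m = (\<Prod>i=0..<m. x - int i)"
  unfolding zbinom_def
  by (rule dvd_mult_div_cancel) (rule dvdI, rule gbinomial_int_mult_fact[symmetric])

lemma of_int_zbinom: "of_int (zbinom x m) = (of_int x :: 'a::field_char_0) gchoose m"
proof -
  have "fact m * (of_int (zbinom x m) :: 'a) = of_int (fact m * zbinom x m)"
    by simp
  also have "\<dots> = fact m * ((of_int x :: 'a) gchoose m)"
    by (simp add: fact_mult_zbinom gbinomial_mult_fact)
  finally show ?thesis
    by simp
qed

definition A :: "nat \<Rightarrow> nat \<Rightarrow> int" where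
  "A a n = (\<Sum>k=0..n. (-1) ^ k * int (n choose k) ^ a * zbinom (4 * int n - 5 * int k) (3 * n))"

text \<open>
  Digit strings may have leading zeros; this makes no difference for sequences with \<open>f 0 = 1\<close>.
\<close>

definition lucas_congruences :: "(nat \<Rightarrow> int) \<Rightarrow> bool" where
  "lucas_congruences f \<longleftrightarrow>
     (\<forall>(p::nat) (n::nat) (r::nat) (d::nat \<Rightarrow> nat).
        prime p \<longrightarrow> (\<forall>i\<le>r. d i < p) \<longrightarrow> n = (\<Sum>i\<le>r. d i * p ^ i) \<longrightarrow>
        [f n = (\<Prod>i\<le>r. f (d i))] (mod int p))"

end

theory Submission
  imports Defs "HOL-Computational_Algebra.Polynomial" "HOL-Computational_Algebra.Formal_Power_Series"
begin

text \<open>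
  For suitable weights \<open>c n k\<close> one has
  \<open>\<Sum>\<^sub>k c n k x\<^bsup>n - k\<^esup> y\<^sup>k = \<Sum>\<^sub>j m n j (xy)\<^sup>j (x + y)\<^bsup>n - 2j\<^esup>\<close>: for \<open>c n k = (n choose k)\<close> with
  only the term \<open>j = 0\<close>, and for \<open>c n k = (n choose k)\<^sup>3\<close> with
  \<open>m n j = (n + j)! / (j!\<^sup>3 (n - 2j)!)\<close> by MacMahon's identity. Take \<open>x = s\<^sup>5\<close>, \<open>y = -1\<close>, \<open>s = 1 + X\<close>.
  With \<open>w = X\<^sup>2 / s\<close> we have \<open>s\<^sup>5 - 1 = X s\<^sup>2 (w\<^sup>2 + 5w + 5)\<close>, and the coefficient of \<open>X\<^bsup>2m\<^esup>\<close> in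
  \<open>s\<^sup>m w\<^sup>i\<close> is 1 if \<open>i = m\<close> and 0 otherwise. Hence the coefficient of \<open>X\<^bsup>3n\<^esup>\<close> in
  \<open>\<Sum>\<^sub>k (-1)\<^sup>k c n k s\<^bsup>4n - 5k\<^esup>\<close> is
  \<open>\<Sum>\<^sub>j (-1)\<^sup>j m n j [w\<^bsup>n + j\<^esup>] (w\<^sup>2 + 5w + 5)\<^bsup>n - 2j\<^esup>\<close>.

  Each summand of the last sum satisfies a Lucas congruence modulo \<open>p\<close> in \<open>n\<close> and \<open>j\<close>
  simultaneously. For \<open>m\<close> this is Lucas' theorem. For the polynomial coefficient it follows from
  Frobenius, by comparing degrees, as long as the last digits \<open>b\<close> of \<open>n\<close> and \<open>d\<close> of \<open>j\<close> satisfy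
  \<open>2d \<le> b\<close> and \<open>b + d < p\<close>; otherwise \<open>m b d\<close> is divisible by \<open>p\<close>.
\<close>

section \<open>Frobenius modulo a prime\<close>

lemma prime_dvd_freshman:
  fixes a b :: "'a :: comm_ring_1"
  assumes "prime p"
  shows "of_nat p dvd (a + b) ^ p - a ^ p - b ^ p"
proof -
  have p: "p \<ge> 2" using assms by (rule prime_ge_2_nat)
  define f where "f = (\<lambda>k. of_nat (p choose k) * a ^ k * b ^ (p - k))"
  have split: "{..p} = insert 0 (insert p {1..<p})" using p by auto
  have "(a + b) ^ p = (\<Sum>k\<le>p. f k)"
    by (simp add: binomial_ring f_def)
  also have "\<dots> = b ^ p + a ^ p + (\<Sum>k\<in>{1..<p}. f k)"
    unfolding split using p by (simp add: f_def)
  finally have "(a + b) ^ p - a ^ p - b ^ p = (\<Sum>k\<in>{1..<p}. f k)"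
    by simp
  moreover have "of_nat p dvd f k" if "k \<in> {1..<p}" for k
  proof -
    have "p dvd (p choose k)"
      using that assms by (intro dvd_choose_prime) auto
    then have "(of_nat p :: 'a) dvd of_nat (p choose k)"
      by (auto simp: dvd_def)
    then show ?thesis unfolding f_def by (intro dvd_mult2)
  qed
  ultimately show ?thesis by (metis dvd_sum)
qed

lemma fermat_int:
  assumes "prime p"
  shows "int p dvd a ^ p - a"
proof (induction a rule: int_induct[where k = 0])
  case base
  then show ?case using assms prime_gt_0_nat[of p] by (simp add: power_0_left)
next
  case (step1 i)
  have "(i + 1) ^ p - (i + 1) = ((i + 1) ^ p - i ^ p - 1 ^ p) + (i ^ p - i)" by simp
  moreover have "int p dvd (i + 1) ^ p - i ^ p - 1 ^ p"
    using prime_dvd_freshman[OF assms, of i 1] by simp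
  ultimately show ?case using step1 by (metis dvd_add)
next
  case (step2 i)
  have "(i - 1) ^ p - (i - 1) = (i ^ p - i) - ((i - 1 + 1) ^ p - (i - 1) ^ p - 1 ^ p)" by simp
  moreover have "int p dvd (i - 1 + 1) ^ p - (i - 1) ^ p - 1 ^ p"
    using prime_dvd_freshman[OF assms, of "i - 1" 1] by simp
  ultimately show ?case using step2 by (metis dvd_diff)
qed

text \<open>Induction over the coefficients: the freshman's dream splits the \<open>p\<close>-th
  power of \<open>a + X * f\<close>, and Fermat's little theorem handles the constant
  \<open>a\<close>.\<close>

lemma poly_frobenius:
  fixes f :: "int poly"
  assumes "prime p"
  shows "of_nat p dvd f ^ p - pcompose f (monom 1 p)"
proof (induction f)
  case 0
  then show ?case using assms prime_gt_0_nat[of p] by (simp add: power_0_left)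
next
  case (pCons a f)
  have eq: "pCons a f = [:a:] + monom 1 1 * f"
    by (simp add: monom_altdef)
  have "pCons a f ^ p - pcompose (pCons a f) (monom 1 p) =
     (([:a:] + monom 1 1 * f) ^ p - [:a:] ^ p - (monom 1 1 * f) ^ p)
      + ([:a:] ^ p - [:a:]) + monom 1 p * (f ^ p - pcompose f (monom 1 p))"
    unfolding pcompose_pCons eq[symmetric]
    by (simp add: power_mult_distrib monom_power algebra_simps)
  moreover have "of_nat p dvd [:a:] ^ p - [:a:]"
    using fermat_int[OF assms, of a]
    by (simp add: of_nat_poly poly_const_pow)
  ultimately show ?case
    using prime_dvd_freshman[OF assms, of "[:a:]" "monom 1 1 * f"] pCons.IH
    by (simp only: dvd_add dvd_mult)
qed

text \<open>All exponents in f(X^p) are multiples of \<open>p\<close>, so a contributing term of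
  \<open>g\<close> has an exponent congruent to \<open>r\<close>; \<open>r < p\<close> and the
  degree bound leave only \<open>r\<close> itself.\<close>

lemma coeff_pcompose_monom_mult:
  fixes f g :: "'a :: comm_ring_1 poly"
  assumes "r < p" "degree g < p + r"
  shows "coeff (pcompose f (monom 1 p) * g) (p * k + r) = coeff f k * coeff g r"
proof (induction f arbitrary: k)
  case 0
  then show ?case by simp
next
  case (pCons a f)
  have "coeff (pcompose (pCons a f) (monom 1 p) * g) (p * k + r) =
      a * coeff g (p * k + r) + coeff (monom 1 p * (pcompose f (monom 1 p) * g)) (p * k + r)"
    by (simp add: pcompose_pCons algebra_simps)
  also have "\<dots> = coeff (pCons a f) k * coeff g r"
  proof (cases k)
    case 0
    then show ?thesis using assms by (simp add: coeff_monom_mult)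
  next
    case (Suc l)
    have "coeff g (p * k + r) = 0"
      using assms Suc by (intro coeff_eq_0) auto
    moreover have "p * k + r - p = p * l + r" using Suc by simp
    ultimately show ?thesis using Suc pCons.IH by (simp add: coeff_monom_mult)
  qed
  finally show ?case .
qed

text \<open>By Frobenius, \<open>f ^ (p * m)\<close> is congruent to (f^m)(X^p). With
  \<open>g\<close> a small power of \<open>f\<close>, this is a Lucas congruence for coefficients of
  powers of \<open>f\<close>.\<close>

lemma coeff_power_lucas:
  fixes f g :: "int poly"
  assumes "prime p" "r < p" "degree g < p + r"
  shows "[coeff (f ^ (p * m) * g) (p * k + r) = coeff (f ^ m) k * coeff g r] (mod int p)"
proof -
  have "of_nat p dvd (f ^ m) ^ p - pcompose (f ^ m) (monom 1 p)"
    by (rule poly_frobenius) fact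
  then have "of_nat p dvd ((f ^ m) ^ p - pcompose (f ^ m) (monom 1 p)) * g"
    by (rule dvd_mult2)
  then have "int p dvd coeff (((f ^ m) ^ p - pcompose (f ^ m) (monom 1 p)) * g) (p * k + r)"
    by (simp add: of_nat_poly const_poly_dvd_iff)
  then show ?thesis
    using coeff_pcompose_monom_mult[OF assms(2,3), of "f ^ m" k]
    by (simp add: cong_iff_dvd_diff left_diff_distrib power_mult mult.commute[of p m])
qed

lemma coeff_one_plus_X_power: "coeff ([:1, 1:] ^ n) k = int (n choose k)"
  by (induction n arbitrary: k) (auto simp: coeff_pCons split: nat.splits)

lemma binomial_lucas:
  assumes "prime p" "b < p" "d < p"
  shows "[int ((p * a + b) choose (p * c + d)) = int (a choose c) * int (b choose d)] (mod int p)"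
proof -
  have "degree ([:1, 1:] ^ b :: int poly) < p + d"
    using assms by (simp add: degree_power_eq)
  from coeff_power_lucas[OF assms(1,3) this, of "[:1, 1:]" a c] show ?thesis
    by (simp add: power_add[symmetric] coeff_one_plus_X_power)
qed

section \<open>MacMahon's identity\<close>

lemma sum_choose_mult_choose_add:
  "(\<Sum>i\<le>m. (m choose i) * (n choose (i + d))) = (m + n) choose (m + d)"
proof -
  have "(m + n) choose (m + d) = (\<Sum>k\<le>m + d. (m choose k) * (n choose (m + d - k)))"
    by (simp add: vandermonde)
  also have "\<dots> = (\<Sum>k\<le>m. (m choose k) * (n choose (m + d - k)))"
    by (rule sum.mono_neutral_right) auto
  also have "\<dots> = (\<Sum>i\<le>m. (m choose i) * (n choose (i + d)))"
    by (rule sum.reindex_bij_witness[of _ "\<lambda>i. m - i" "\<lambda>i. m - i"])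
       (auto simp: binomial_symmetric[symmetric])
  finally show ?thesis by simp
qed

text \<open>Vandermonde three times: it expands the last factor as a sum over \<open>i\<close>,
  evaluates the inner sum over \<open>j\<close>, and then evaluates the remaining sum over
  \<open>i\<close>.\<close>

lemma sum_choose_choose_choose_add:
  "(\<Sum>j\<le>a. (a choose j) * (b choose j) * ((a + b + j) choose j)) = ((a + b) choose a)\<^sup>2"
proof -
  have vander: "(a + b + j) choose j = (\<Sum>i\<le>a. ((a + b) choose i) * (j choose i))" if "j \<le> a" for j
  proof -
    have "(a + b + j) choose j = (\<Sum>i\<le>j. ((a + b) choose i) * (j choose (j - i)))"
      by (simp add: vandermonde)
    also have "\<dots> = (\<Sum>i\<le>j. ((a + b) choose i) * (j choose i))"
      by (intro sum.cong) (auto simp: binomial_symmetric[symmetric])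
    also have "\<dots> = (\<Sum>i\<le>a. ((a + b) choose i) * (j choose i))"
      using that by (intro sum.mono_neutral_left) auto
    finally show ?thesis .
  qed
  have inner: "((a + b) choose i) * (\<Sum>j\<le>a. (a choose j) * (b choose j) * (j choose i)) =
      ((a + b) choose a) * ((a choose i) * (b choose i))" if "i \<le> a" for i
  proof -
    have "(\<Sum>j\<le>a. (a choose j) * (b choose j) * (j choose i)) =
        (\<Sum>j\<in>{i..a}. (a choose j) * (b choose j) * (j choose i))"
      by (rule sum.mono_neutral_right) auto
    also have "\<dots> = (\<Sum>j\<in>{i..a}. (a choose i) * (((a - i) choose (j - i)) * (b choose j)))"
    proof (rule sum.cong[OF refl])
      fix j assume "j \<in> {i..a}"
      then have "(a choose j) * (j choose i) = (a choose i) * ((a - i) choose (j - i))"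
        by (intro choose_mult) auto
      then show "(a choose j) * (b choose j) * (j choose i)
          = (a choose i) * (((a - i) choose (j - i)) * (b choose j))"
        by (simp add: mult_ac)
    qed
    also have "\<dots> = (a choose i) * (\<Sum>j\<in>{i..a}. ((a - i) choose (j - i)) * (b choose j))"
      by (simp add: sum_distrib_left)
    also have "(\<Sum>j\<in>{i..a}. ((a - i) choose (j - i)) * (b choose j)) =
        (\<Sum>l\<le>a - i. ((a - i) choose l) * (b choose (l + i)))"
      by (rule sum.reindex_bij_witness[of _ "\<lambda>l. l + i" "\<lambda>j. j - i"]) (use that in auto)
    also have "\<dots> = (a - i + b) choose a"
      using that by (simp add: sum_choose_mult_choose_add)
    finally have sum_eq: "(\<Sum>j\<le>a. (a choose j) * (b choose j) * (j choose i)) =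
        (a choose i) * ((a - i + b) choose a)" .
    \<comment> \<open>For \<open>i \<le> b\<close> both sides are (a+b)! / (a! i! (b-i)!); for
      \<open>i > b\<close> both vanish.\<close>
    have "((a + b) choose i) * ((a - i + b) choose a) = ((a + b) choose a) * (b choose i)"
    proof (cases "i \<le> b")
      case True
      have "((a + b) choose (a + i)) * ((a + i) choose i) = ((a + b) choose i) * ((a + b - i) choose (a + i - i))"
        by (rule choose_mult) (use True in auto)
      moreover have "((a + b) choose (a + i)) * ((a + i) choose a) = ((a + b) choose a) * ((a + b - a) choose (a + i - a))"
        by (rule choose_mult) (use True in auto)
      moreover have "(a + i) choose i = (a + i) choose a"
        using binomial_symmetric[of i "a + i"] by simp
      ultimately show ?thesis using that by simp
    qed (use that in \<open>auto simp: binomial_eq_0\<close>)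
    then show ?thesis unfolding sum_eq by (simp add: mult_ac)
  qed
  have "(\<Sum>j\<le>a. (a choose j) * (b choose j) * ((a + b + j) choose j)) =
      (\<Sum>j\<le>a. \<Sum>i\<le>a. ((a + b) choose i) * ((a choose j) * (b choose j) * (j choose i)))"
    by (intro sum.cong refl) (auto simp: vander sum_distrib_left mult_ac)
  also have "\<dots> = (\<Sum>i\<le>a. \<Sum>j\<le>a. ((a + b) choose i) * ((a choose j) * (b choose j) * (j choose i)))"
    by (rule sum.swap)
  also have "\<dots> = (\<Sum>i\<le>a. ((a + b) choose a) * ((a choose i) * (b choose i)))"
    by (intro sum.cong refl) (auto simp: inner sum_distrib_left[symmetric])
  also have "\<dots> = ((a + b) choose a) * (\<Sum>i\<le>a. (a choose i) * (b choose (i + 0)))"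
    by (simp add: sum_distrib_left)
  also have "\<dots> = ((a + b) choose a)\<^sup>2"
    by (subst sum_choose_mult_choose_add) (simp add: power2_eq_square)
  finally show ?thesis .
qed

text \<open>The product form of (n+j)! / (j!^3 (n-2j)!) makes integrality evident, vanishes for
  \<open>2 * j > n\<close>, and lets Lucas' theorem act on its factors.\<close>

definition macmahon :: "nat \<Rightarrow> nat \<Rightarrow> nat" where
  "macmahon n j = (n choose (2 * j)) * ((2 * j) choose j) * ((n + j) choose j)"

text \<open>Apart from the common factor \<open>(n + j) choose j\<close>, both sides are n! / (j!^2
  (k-j)! (n-k-j)!).\<close>

lemma macmahon_mult_choose:
  assumes "j \<le> k" "j + k \<le> n"
  shows "macmahon n j * ((n - 2 * j) choose (k - j)) =
    (n choose k) * ((k choose j) * ((n - k) choose j) * ((n + j) choose j))"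
proof -
  have "real ((n choose (2 * j)) * ((2 * j) choose j) * ((n - 2 * j) choose (k - j))) =
      real ((n choose k) * (k choose j) * ((n - k) choose j))"
  proof -
    have "n - 2 * j - (k - j) = n - k - j" "2 * j - j = j" using assms by auto
    then show ?thesis using assms by (simp add: binomial_fact field_simps)
  qed
  then have "(n choose (2 * j)) * ((2 * j) choose j) * ((n - 2 * j) choose (k - j)) =
      (n choose k) * (k choose j) * ((n - k) choose j)"
    by linarith
  then show ?thesis unfolding macmahon_def by (simp add: mult_ac)
qed

text \<open>This compares the coefficients of \<open>x ^ (n - k) * y ^ k\<close> in MacMahon's
  identity. One factor \<open>n choose k\<close> comes out of the sum, and
  \<open>sum_choose_choose_choose_add\<close> at \<open>k\<close> and \<open>n - k\<close> gives the
  square.\<close>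

lemma choose_cubed_eq_sum_macmahon:
  assumes "k \<le> n"
  shows "(n choose k) ^ 3 = (\<Sum>j | j \<le> k \<and> j + k \<le> n. macmahon n j * ((n - 2 * j) choose (k - j)))"
proof -
  have "(\<Sum>j | j \<le> k \<and> j + k \<le> n. macmahon n j * ((n - 2 * j) choose (k - j))) =
      (\<Sum>j | j \<le> k \<and> j + k \<le> n. (n choose k) * ((k choose j) * ((n - k) choose j) * ((n + j) choose j)))"
    by (rule sum.cong) (auto simp: macmahon_mult_choose)
  also have "\<dots> = (\<Sum>j\<le>k. (n choose k) * ((k choose j) * ((n - k) choose j) * ((n + j) choose j)))"
    using assms by (intro sum.mono_neutral_left) auto
  also have "\<dots> = (n choose k) * (\<Sum>j\<le>k. (k choose j) * ((n - k) choose j) * ((k + (n - k) + j) choose j))"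
    using assms by (simp add: sum_distrib_left)
  also have "\<dots> = (n choose k) ^ 3"
    using assms by (simp only: sum_choose_choose_choose_add) (simp add: power2_eq_square power3_eq_cube)
  finally show ?thesis by simp
qed

lemma macmahon_identity:
  fixes x y :: "'a :: comm_ring_1"
  shows "(\<Sum>k\<le>n. of_nat ((n choose k) ^ 3) * x ^ (n - k) * y ^ k) =
    (\<Sum>j | 2 * j \<le> n. of_nat (macmahon n j) * (x * y) ^ j * (x + y) ^ (n - 2 * j))"
proof -
  define g where "g = (\<lambda>j k. of_nat (macmahon n j * ((n - 2 * j) choose (k - j))) * x ^ (n - k) * y ^ k)"
  have fin: "finite {j. 2 * j \<le> n}" by (rule finite_subset[of _ "{..n}"]) auto
  have fin': "finite {j. j \<le> k \<and> j + k \<le> n}" for k by (rule finite_subset[of _ "{..n}"]) auto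
  have "(\<Sum>k\<le>n. of_nat ((n choose k) ^ 3) * x ^ (n - k) * y ^ k) =
      (\<Sum>k\<le>n. \<Sum>j | j \<le> k \<and> j + k \<le> n. g j k)"
    by (intro sum.cong refl)
       (simp add: choose_cubed_eq_sum_macmahon g_def sum_distrib_right del: of_nat_power of_nat_mult)
  \<comment> \<open>Both sums run over the pairs with \<open>j \<le> k \<le> n - j\<close>; the new
    index is \<open>i = k - j\<close>.\<close>
  also have "\<dots> = (\<Sum>j | 2 * j \<le> n. \<Sum>i\<le>n - 2 * j. g j (i + j))"
    unfolding sum.Sigma[OF finite_atMost ballI[OF fin']] sum.Sigma[OF fin ballI[OF finite_atMost]]
    by (rule sum.reindex_bij_witness[of _ "\<lambda>(j, i). (i + j, j)" "\<lambda>(k, j). (j, k - j)"]) auto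
  also have "\<dots> = (\<Sum>j | 2 * j \<le> n. of_nat (macmahon n j) * (x * y) ^ j * (x + y) ^ (n - 2 * j))"
  proof (rule sum.cong[OF refl])
    fix j assume "j \<in> {j. 2 * j \<le> n}"
    then have j: "2 * j \<le> n" by simp
    have "(x + y) ^ (n - 2 * j) =
        (\<Sum>i\<le>n - 2 * j. of_nat ((n - 2 * j) choose i) * y ^ i * x ^ (n - 2 * j - i))"
      by (subst add.commute) (rule binomial_ring)
    then have "of_nat (macmahon n j) * (x * y) ^ j * (x + y) ^ (n - 2 * j) =
       (\<Sum>i\<le>n - 2 * j. of_nat (macmahon n j) * (x * y) ^ j
          * (of_nat ((n - 2 * j) choose i) * y ^ i * x ^ (n - 2 * j - i)))"
      by (simp add: sum_distrib_left)
    also have "\<dots> = (\<Sum>i\<le>n - 2 * j. g j (i + j))"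
    proof (rule sum.cong[OF refl])
      fix i assume "i \<in> {..n - 2 * j}"
      then have "n - (i + j) = j + (n - 2 * j - i)" using j by auto
      then show "of_nat (macmahon n j) * (x * y) ^ j
          * (of_nat ((n - 2 * j) choose i) * y ^ i * x ^ (n - 2 * j - i)) = g j (i + j)"
        by (simp add: g_def power_add power_mult_distrib algebra_simps)
    qed
    finally show "(\<Sum>i\<le>n - 2 * j. g j (i + j)) =
        of_nat (macmahon n j) * (x * y) ^ j * (x + y) ^ (n - 2 * j)" ..
  qed
  finally show ?thesis .
qed

text \<open>Lucas' theorem applies directly to each binomial factor as long as \<open>b + d\<close>
  and \<open>2 * d\<close> are still digits; in the carry cases both sides turn out to be divisible
  by \<open>p\<close>.\<close>

lemma macmahon_lucas:
  assumes "prime p" "b < p" "d < p"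
  shows "[int (macmahon (p * a + b) (p * c + d)) = int (macmahon a c) * int (macmahon b d)] (mod int p)"
proof -
  \<comment> \<open>If \<open>e + d\<close> carries, its last digit \<open>e + d - p\<close> is less
    than \<open>d\<close>, so both sides are 0 modulo \<open>p\<close>.\<close>
  have carry: "[int ((p * u + (e + d)) choose (p * c + d)) =
      int (u choose c) * int ((e + d) choose d)] (mod int p)"
    if "e < p" for e u
  proof (cases "e + d < p")
    case True
    then show ?thesis using binomial_lucas[OF assms(1) True assms(3)] by simp
  next
    case False
    have less: "e + d - p < p" "e + d - p < d" using that assms False by auto
    have eqs: "p * Suc u + (e + d - p) = p * u + (e + d)" "p * 1 + (e + d - p) = e + d"
      using False by auto
    have "[int ((p * u + (e + d)) choose (p * c + d)) = 0] (mod int p)"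
      using binomial_lucas[OF assms(1) less(1) assms(3), of "Suc u" c] less(2)
      by (simp only: eqs binomial_eq_0 of_nat_0 mult_zero_right)
    moreover have "[int ((e + d) choose d) = 0] (mod int p)"
      using binomial_lucas[OF assms(1) less(1) assms(3), of 1 0] less(2)
      by (simp only: eqs binomial_eq_0 of_nat_0 mult_zero_right add_0)
    ultimately show ?thesis
      by (simp add: cong_0_iff cong_iff_dvd_diff dvd_diff)
  qed
  have 1: "[int ((p * a + b + (p * c + d)) choose (p * c + d)) =
      int ((a + c) choose c) * int ((b + d) choose d)] (mod int p)"
    using carry[OF assms(2), of "a + c"] by (simp add: algebra_simps)
  have 2: "[int ((2 * (p * c + d)) choose (p * c + d)) =
      int ((2 * c) choose c) * int ((2 * d) choose d)] (mod int p)"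
    using carry[OF assms(3), of "2 * c"] by (simp add: algebra_simps flip: mult_2)
  \<comment> \<open>The two factors are treated together: when \<open>2 * d \<ge> p\<close>, the
    second factor on the left is divisible by \<open>p\<close>, while on the right
    \<open>b choose (2 * d)\<close> is 0 because \<open>b < p\<close>.\<close>
  have 3: "[int ((p * a + b) choose (2 * (p * c + d))) * int ((2 * (p * c + d)) choose (p * c + d)) =
      (int (a choose (2 * c)) * int (b choose (2 * d))) * (int ((2 * c) choose c) * int ((2 * d) choose d))] (mod int p)"
  proof (cases "2 * d < p")
    case True
    have eq: "2 * (p * c + d) = p * (2 * c) + 2 * d" by simp
    have "[int ((p * a + b) choose (2 * (p * c + d))) =
        int (a choose (2 * c)) * int (b choose (2 * d))] (mod int p)"
      using binomial_lucas[OF assms(1,2) True, of a "2 * c"] by (simp only: eq)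
    from cong_mult[OF this 2] show ?thesis .
  next
    case False
    then have less: "2 * d - p < p" "2 * d - p < d" using assms by auto
    have "2 * (p * c + d) = p * Suc (2 * c) + (2 * d - p)" using False by (simp add: algebra_simps)
    then have "[int ((2 * (p * c + d)) choose (p * c + d)) = 0] (mod int p)"
      using binomial_lucas[OF assms(1) less(1) assms(3), of "Suc (2 * c)" c] less(2)
      by (simp only: binomial_eq_0 of_nat_0 mult_zero_right)
    moreover have "b choose (2 * d) = 0" using False assms by (simp add: binomial_eq_0)
    ultimately show ?thesis
      by (simp only: cong_0_iff dvd_mult of_nat_0 mult_zero_right mult_zero_left)
  qed
  from cong_mult[OF 3 1] show ?thesis
    unfolding macmahon_def by (simp add: mult_ac)
qed

text \<open>The last digit of \<open>b + d\<close> is \<open>b + d - p < d\<close>, so Lucas'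
  theorem makes the factor \<open>(b + d) choose d\<close> divisible by \<open>p\<close>.\<close>

lemma macmahon_dvd:
  assumes "prime p" "b < p" "d < p" "b + d \<ge> p"
  shows "p dvd macmahon b d"
proof -
  have less: "b + d - p < p" "b + d - p < d" using assms by auto
  have "[int ((p * 1 + (b + d - p)) choose (p * 0 + d)) = 0] (mod int p)"
    using binomial_lucas[OF assms(1) less(1) assms(3), of 1 0] less(2)
    by (simp only: binomial_eq_0 of_nat_0 mult_zero_right)
  then have "p dvd ((b + d) choose d)"
    using assms by (simp add: cong_0_iff)
  then show ?thesis by (simp add: macmahon_def)
qed

section \<open>Coefficients in powers of \<open>X\<^sup>2 / (1 + X)\<close>\<close>

unbundle fps_syntax

abbreviation Q :: "int poly" where "Q \<equiv> [:5, 5, 1:]"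

abbreviation W :: "rat fps" where "W \<equiv> fps_X ^ 2 * fps_binomial (- 1)"

text \<open>Multiplying by \<open>W\<close> lowers the exponent of 1 + X by one and shifts
  coefficients by two places.\<close>

lemma fps_nth_binomial_mult_W:
  "(fps_binomial (of_nat (Suc m)) * (W * g)) $ (2 * Suc m) = (fps_binomial (of_nat m) * g) $ (2 * m)"
proof -
  have "fps_binomial (of_nat (Suc m)) * (W * g) =
      fps_X ^ 2 * ((fps_binomial (of_nat (Suc m)) * fps_binomial (- 1)) * g)"
    by (simp only: mult_ac)
  also have "fps_binomial (of_nat (Suc m) :: rat) * fps_binomial (- 1) = fps_binomial (of_nat m)"
    by (simp flip: fps_binomial_add_mult)
  finally show ?thesis by (simp only: fps_X_power_mult_nth) simp
qed

lemma fps_nth_binomial_mult_Q_W: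
  "(fps_binomial (of_nat m) * (W ^ 2 + 5 * W + 5) ^ N) $ (2 * m) = of_int (coeff (Q ^ N) m)"
proof (induction N arbitrary: m)
  case 0
  \<comment> \<open>For \<open>N = 0\<close> the coefficient is \<open>m choose (2 * m)\<close>,
    which is 1 if \<open>m = 0\<close> and 0 otherwise.\<close>
  show ?case
    by (cases "m = 0") (simp_all add: binomial_gbinomial[symmetric] binomial_eq_0)
next
  case (Suc N)
  define P where "P = (W ^ 2 + 5 * W + 5) ^ N"
  \<comment> \<open>By \<open>L_W\<close> and \<open>L_W0\<close>, multiplication by
    \<open>W\<close> acts on \<open>L m\<close> as multiplication by the variable acts on the
    \<open>m\<close>-th coefficient of a polynomial.\<close>
  define L where "L = (\<lambda>m g. (fps_binomial (of_nat m :: rat) * g) $ (2 * m))"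
  have L_W: "L (Suc m) (W * g) = L m g" for m g
    unfolding L_def by (rule fps_nth_binomial_mult_W)
  have L_W0: "L 0 (W * g) = 0" for g
    by (simp add: L_def)
  have L_5: "L m (5 * g) = 5 * L m g" for m g
    using fps_mult_left_const_nth[of 5 "fps_binomial (of_nat m) * g" "2 * m"]
    by (simp add: L_def mult_ac fps_numeral_fps_const)
  have L_add: "L m (g + h) = L m g + L m h" for m g h
    by (simp add: L_def distrib_left)
  have IH: "L m P = of_int (coeff (Q ^ N) m)" for m
    unfolding L_def P_def by (rule Suc.IH)
  have expand: "(W ^ 2 + 5 * W + 5) ^ Suc N = W * (W * P) + 5 * (W * P) + 5 * P"
    by (simp only: P_def power_Suc power2_eq_square distrib_right mult.assoc)
  have "L m (W * (W * P) + 5 * (W * P) + 5 * P) = of_int (coeff (Q ^ Suc N) m)"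
  proof (cases m)
    case 0
    then show ?thesis by (simp add: L_add L_5 L_W0 IH)
  next
    case (Suc m')
    then show ?thesis
      by (cases m') (simp_all add: L_add L_5 L_W0 L_W IH)
  qed
  then show ?case unfolding L_def expand .
qed

text \<open>Since \<open>W * (1 + fps_X) = fps_X ^ 2\<close>, the factor (1+X)^2 clears denominators
  and leaves X^4 + 5X^3 + 10X^2 + 10X + 5.\<close>

lemma one_plus_X_power_5:
  "(1 + fps_X) ^ 5 - 1 = fps_X * (1 + fps_X) ^ 2 * (W ^ 2 + 5 * W + 5)"
proof -
  have "W * (1 + fps_X) = fps_X ^ 2 * (fps_binomial (- 1) * fps_binomial 1)"
    by (simp only: fps_binomial_1 mult.assoc)
  also have "\<dots> = fps_X ^ 2" by (simp flip: fps_binomial_add_mult)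
  finally have W: "W * (1 + fps_X) = fps_X ^ 2" .
  have "(1 + fps_X) ^ 2 * (W ^ 2 + 5 * W + 5) =
      (W * (1 + fps_X)) ^ 2 + 5 * (W * (1 + fps_X)) * (1 + fps_X) + 5 * (1 + fps_X) ^ 2"
    by (simp add: algebra_simps power2_eq_square)
  also have "\<dots> = (fps_X ^ 2) ^ 2 + 5 * fps_X ^ 2 * (1 + fps_X) + 5 * (1 + fps_X) ^ 2"
    by (simp only: W)
  finally have "fps_X * (1 + fps_X) ^ 2 * (W ^ 2 + 5 * W + 5) =
      fps_X * ((fps_X ^ 2) ^ 2 + 5 * fps_X ^ 2 * (1 + fps_X) + 5 * (1 + fps_X) ^ 2)"
    by (simp only: mult.assoc)
  also have "\<dots> = (1 + fps_X) ^ 5 - 1"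
    by (simp add: algebra_simps eval_nat_numeral)
  finally show ?thesis ..
qed

text \<open>Keeping \<open>c\<close> and \<open>m\<close> abstract covers both exponents of the
  binomial coefficient at once.\<close>

lemma sum_zbinom_eq_sum_coeff:
  fixes c m :: "nat \<Rightarrow> nat"
  assumes "\<And>x y :: rat fps. (\<Sum>k\<le>n. of_nat (c k) * x ^ (n - k) * y ^ k) =
    (\<Sum>j | 2 * j \<le> n. of_nat (m j) * (x * y) ^ j * (x + y) ^ (n - 2 * j))"
  shows "(\<Sum>k\<le>n. (- 1) ^ k * int (c k) * zbinom (4 * int n - 5 * int k) (3 * n)) =
    (\<Sum>j | 2 * j \<le> n. (- 1) ^ j * int (m j) * coeff (Q ^ (n - 2 * j)) (n + j))"
proof -
  define B :: "rat \<Rightarrow> rat fps" where "B = fps_binomial"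
  define S :: "rat fps" where "S = 1 + fps_X"
  define R where "R = W ^ 2 + 5 * W + 5"
  have B_add: "B x * B y = B (x + y)" for x y by (simp add: B_def fps_binomial_add_mult)
  have S_pow: "(S ^ i) ^ k = B (of_nat (i * k))" for i k
    unfolding power_mult[symmetric] by (simp only: B_def S_def fps_binomial_of_nat)
  have "rat_of_int (\<Sum>k\<le>n. (- 1) ^ k * int (c k) * zbinom (4 * int n - 5 * int k) (3 * n)) =
      (\<Sum>k\<le>n. fps_const ((- 1) ^ k * of_nat (c k)) * B (of_int (4 * int n - 5 * int k))) $ (3 * n)"
    by (simp add: fps_sum_nth B_def of_int_zbinom)
  \<comment> \<open>Since 4n - 5k = -n + 5(n-k), pulling out (1+X)^(-n) leaves the hypothesis at
    \<open>x = S ^ 5\<close>, \<open>y = -1\<close>.\<close>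
  also have "(\<Sum>k\<le>n. fps_const ((- 1) ^ k * of_nat (c k)) * B (of_int (4 * int n - 5 * int k))) =
      B (- of_nat n) * (\<Sum>k\<le>n. of_nat (c k) * (S ^ 5) ^ (n - k) * (- 1) ^ k)"
    unfolding sum_distrib_left
  proof (rule sum.cong[OF refl])
    fix k assume "k \<in> {..n}"
    then have "B (of_int (4 * int n - 5 * int k)) = B (- of_nat n) * (S ^ 5) ^ (n - k)"
      by (simp only: S_pow B_add) (simp add: of_nat_diff algebra_simps)
    moreover have "fps_const ((- 1) ^ k * of_nat (c k)) = of_nat (c k) * (- 1 :: rat fps) ^ k"
      by (simp add: fps_of_nat[symmetric] fps_const_mult[symmetric] fps_const_power[symmetric]
            fps_const_neg[symmetric] del: fps_const_mult fps_const_power fps_const_neg)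
    ultimately show "fps_const ((- 1) ^ k * of_nat (c k)) * B (of_int (4 * int n - 5 * int k)) =
        B (- of_nat n) * (of_nat (c k) * (S ^ 5) ^ (n - k) * (- 1) ^ k)"
      by (simp add: mult_ac)
  qed
  also have "\<dots> = B (- of_nat n) *
      (\<Sum>j | 2 * j \<le> n. of_nat (m j) * (S ^ 5 * (- 1)) ^ j * (S ^ 5 + (- 1)) ^ (n - 2 * j))"
    by (simp only: assms)
  also have "\<dots> = (\<Sum>j | 2 * j \<le> n.
      fps_const ((- 1) ^ j * of_nat (m j)) * (fps_X ^ (n - 2 * j) * (B (of_nat (n + j)) * R ^ (n - 2 * j))))"
    unfolding sum_distrib_left
  proof (rule sum.cong[OF refl])
    fix j assume "j \<in> {j. 2 * j \<le> n}"
    then have j: "2 * j \<le> n" by simp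
    have "S ^ 5 + (- 1) = fps_X * S ^ 2 * R"
      unfolding R_def S_def using one_plus_X_power_5 by simp
    then have "B (- of_nat n) * (of_nat (m j) * (S ^ 5 * (- 1)) ^ j * (S ^ 5 + (- 1)) ^ (n - 2 * j)) =
      (of_nat (m j) * (- 1) ^ j) * (fps_X ^ (n - 2 * j) *
        ((B (- of_nat n) * ((S ^ 5) ^ j * (S ^ 2) ^ (n - 2 * j))) * R ^ (n - 2 * j)))"
      by (simp only: power_mult_distrib mult_ac)
    \<comment> \<open>The exponents add up to -n + 5j + 2(n-2j) = n + j.\<close>
    also have "B (- of_nat n) * ((S ^ 5) ^ j * (S ^ 2) ^ (n - 2 * j)) = B (of_nat (n + j))"
      using j by (simp only: S_pow B_add) (simp add: of_nat_diff algebra_simps)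
    also have "of_nat (m j) * (- 1 :: rat fps) ^ j = fps_const ((- 1) ^ j * of_nat (m j))"
      by (simp add: fps_of_nat[symmetric] fps_const_mult[symmetric] fps_const_power[symmetric]
            fps_const_neg[symmetric] del: fps_const_mult fps_const_power fps_const_neg)
    finally show "B (- of_nat n) * (of_nat (m j) * (S ^ 5 * (- 1)) ^ j * (S ^ 5 + (- 1)) ^ (n - 2 * j)) =
      fps_const ((- 1) ^ j * of_nat (m j)) * (fps_X ^ (n - 2 * j) * (B (of_nat (n + j)) * R ^ (n - 2 * j)))" .
  qed
  also have "\<dots> $ (3 * n) = rat_of_int (\<Sum>j | 2 * j \<le> n. (- 1) ^ j * int (m j) * coeff (Q ^ (n - 2 * j)) (n + j))"
    unfolding fps_sum_nth of_int_sum
  proof (rule sum.cong[OF refl])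
    fix j assume "j \<in> {j. 2 * j \<le> n}"
    \<comment> \<open>After the shift by n - 2j the index is twice the exponent n + j of 1 + X, as
      \<open>fps_nth_binomial_mult_Q_W\<close> requires.\<close>
    then have "\<not> 3 * n < n - 2 * j" "3 * n - (n - 2 * j) = 2 * (n + j)" by auto
    then have "(fps_X ^ (n - 2 * j) * (B (of_nat (n + j)) * R ^ (n - 2 * j))) $ (3 * n) =
        of_int (coeff (Q ^ (n - 2 * j)) (n + j))"
      unfolding B_def R_def fps_X_power_mult_nth by (simp only: if_False fps_nth_binomial_mult_Q_W)
    then show "(fps_const ((- 1) ^ j * of_nat (m j)) *
          (fps_X ^ (n - 2 * j) * (B (of_nat (n + j)) * R ^ (n - 2 * j)))) $ (3 * n) =
        rat_of_int ((- 1) ^ j * int (m j) * coeff (Q ^ (n - 2 * j)) (n + j))"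
      by simp
  qed
  finally show ?thesis by (simp only: of_int_eq_iff)
qed

section \<open>Lucas congruences\<close>

text \<open>The hypotheses make the digitwise computation of \<open>n - 2 * j\<close> free of
  borrows and that of \<open>n + j\<close> free of a carry from the last digit, so
  \<open>coeff_power_lucas\<close> applies.\<close>

lemma coeff_Q_lucas:
  assumes "prime p" "2 * c \<le> a" "2 * d \<le> b" "b + d < p"
  shows "[coeff (Q ^ (p * a + b - 2 * (p * c + d))) (p * a + b + (p * c + d)) =
    coeff (Q ^ (a - 2 * c)) (a + c) * coeff (Q ^ (b - 2 * d)) (b + d)] (mod int p)"
proof -
  obtain a' b' where ab: "a = 2 * c + a'" "b = 2 * d + b'"
    using assms by (metis le_iff_add)
  \<comment> \<open>The degree is 2(b-2d) = (b+d) + (b-5d), and \<open>b < p\<close>.\<close>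
  have deg: "degree (Q ^ b') < p + (b + d)"
    using assms(4) ab by (simp add: degree_power_eq)
  have "p * a + b - 2 * (p * c + d) = p * a' + b'" "p * a + b + (p * c + d) = p * (a + c) + (b + d)"
    "a - 2 * c = a'" "b - 2 * d = b'"
    by (simp_all add: ab algebra_simps)
  moreover from coeff_power_lucas[OF assms(1,4) deg, of Q a' "a + c"]
  have "[coeff (Q ^ (p * a' + b')) (p * (a + c) + (b + d)) =
      coeff (Q ^ a') (a + c) * coeff (Q ^ b') (b + d)] (mod int p)"
    by (simp only: power_add)
  ultimately show ?thesis by (simp only:)
qed

text \<open>Induction on the number of digits, splitting off the lowest; \<open>n'\<close> is the
  number formed by the others.\<close>

lemma lucas_congruencesI:
  assumes "f 0 = 1"
    and step: "\<And>p a b. prime p \<Longrightarrow> b < p \<Longrightarrow> [f (p * a + b) = f a * f b] (mod int p)"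
  shows "lucas_congruences f"
  unfolding lucas_congruences_def
proof (intro allI impI)
  fix p n r :: nat and d :: "nat \<Rightarrow> nat"
  assume p: "prime p" and "\<forall>i\<le>r. d i < p" and "n = (\<Sum>i\<le>r. d i * p ^ i)"
  then show "[f n = (\<Prod>i\<le>r. f (d i))] (mod int p)"
  proof (induction r arbitrary: d n)
    case 0
    then show ?case by simp
  next
    case (Suc r)
    define n' where "n' = (\<Sum>i\<le>r. d (Suc i) * p ^ i)"
    have n: "n = p * n' + d 0"
      unfolding Suc.prems(3) n'_def by (subst sum.atMost_Suc_shift) (simp add: sum_distrib_left mult_ac)
    have "[f n' = (\<Prod>i\<le>r. f (d (Suc i)))] (mod int p)"
      using Suc.prems by (intro Suc.IH) (auto simp: n'_def)
    then have "[f n' * f (d 0) = (\<Prod>i\<le>r. f (d (Suc i))) * f (d 0)] (mod int p)"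
      by (rule cong_scalar_right)
    moreover have "[f n = f n' * f (d 0)] (mod int p)"
      unfolding n using Suc.prems by (intro step) auto
    ultimately show ?case
      by (subst prod.atMost_Suc_shift) (metis cong_trans mult.commute)
  qed
qed

text \<open>Writing the summation index as \<open>p * c + d\<close>, each summand factors modulo
  \<open>p\<close> into one depending on \<open>a\<close>, \<open>c\<close> and one depending on
  \<open>b\<close>, \<open>d\<close>, so the double sum becomes a product.\<close>

lemma lucas_congruences_sum_coeff:
  fixes m :: "nat \<Rightarrow> nat \<Rightarrow> nat"
  assumes f: "\<And>n. f n = (\<Sum>j | 2 * j \<le> n. (- 1) ^ j * int (m n j) * coeff (Q ^ (n - 2 * j)) (n + j))"
    and m00: "m 0 0 = 1"
    and zero: "\<And>n j. 2 * j > n \<Longrightarrow> m n j = 0"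
    and lucas: "\<And>p a b c d. prime p \<Longrightarrow> b < p \<Longrightarrow> d < p \<Longrightarrow>
      [int (m (p * a + b) (p * c + d)) = int (m a c) * int (m b d)] (mod int p)"
    and dvd: "\<And>p b d. prime p \<Longrightarrow> b < p \<Longrightarrow> d < p \<Longrightarrow> b + d \<ge> p \<Longrightarrow> p dvd m b d"
  shows "lucas_congruences f"
proof (rule lucas_congruencesI)
  show "f 0 = 1" by (simp add: f m00)
next
  fix p a b :: nat
  assume p: "prime p" and b: "b < p"
  define t where "t = (\<lambda>n j. (- 1) ^ j * int (m n j) * coeff (Q ^ (n - 2 * j)) (n + j))"
  have f_eq: "f n = (\<Sum>j<K. t n j)" if "n < K" for n K
    unfolding f t_def using that by (intro sum.mono_neutral_left) (auto simp: zero)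
  have t: "[t (p * a + b) (p * c + d) = t a c * t b d] (mod int p)" if d: "d < p" for c d
  proof (cases "2 * c \<le> a \<and> 2 * d \<le> b \<and> b + d < p")
    case True
    \<comment> \<open>Fermat's little theorem covers \<open>p = 2\<close> as well, so the sign also
      satisfies a Lucas congruence.\<close>
    have "[(- 1) ^ p = (- 1 :: int)] (mod int p)"
      using fermat_int[OF p, of "- 1"] by (simp add: cong_iff_dvd_diff)
    from cong_mult[OF cong_pow[OF this, of c] cong_refl[of "(- 1) ^ d"]]
    have "[(- 1) ^ (p * c + d) = (- 1 :: int) ^ c * (- 1) ^ d] (mod int p)"
      by (simp only: power_add power_mult)
    from cong_mult[OF cong_mult[OF this lucas[OF p b d, of a c]] coeff_Q_lucas[of p c a d b]] p True
    show ?thesis by (simp add: t_def mult_ac)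
  next
    case False
    \<comment> \<open>Outside the range of \<open>coeff_Q_lucas\<close> the weights alone make both
      sides 0 modulo \<open>p\<close>.\<close>
    have "int p dvd int (m a c) * int (m b d)"
    proof (cases "2 * c \<le> a \<and> 2 * d \<le> b")
      case True
      then have "p dvd m b d" using False p b d by (intro dvd) auto
      then show ?thesis by simp
    next
      case False
      then show ?thesis using zero by (auto simp: not_le)
    qed
    moreover from this have "int p dvd int (m (p * a + b) (p * c + d))"
      using lucas[OF p b d, of a c] by (metis cong_dvd_iff cong_sym)
    ultimately have "int p dvd t (p * a + b) (p * c + d)"
        "int p dvd (int (m a c) * int (m b d)) * ((- 1) ^ c * coeff (Q ^ (a - 2 * c)) (a + c)
          * ((- 1) ^ d * coeff (Q ^ (b - 2 * d)) (b + d)))"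
      unfolding t_def by (auto intro: dvd_mult dvd_mult2)
    moreover have "t a c * t b d = (int (m a c) * int (m b d)) *
        ((- 1) ^ c * coeff (Q ^ (a - 2 * c)) (a + c) * ((- 1) ^ d * coeff (Q ^ (b - 2 * d)) (b + d)))"
      unfolding t_def by (simp only: mult_ac)
    ultimately have "int p dvd t (p * a + b) (p * c + d)" "int p dvd t a c * t b d"
      by simp_all
    then show ?thesis by (metis cong_0_iff cong_sym cong_trans)
  qed
  \<comment> \<open>The range is padded with zero terms to \<open>Suc a\<close> full blocks of
    length \<open>p\<close>, so that \<open>d\<close> runs over all digits for every
    \<open>c\<close>.\<close>
  have "f (p * a + b) = (\<Sum>j<Suc a * p. t (p * a + b) j)"
    using b by (intro f_eq) (simp add: mult.commute)
  also have "\<dots> = (\<Sum>c<Suc a. \<Sum>j = c * p..<c * p + p. t (p * a + b) j)"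
    by (rule sum.nat_group[symmetric])
  also have "\<dots> = (\<Sum>c<Suc a. \<Sum>d<p. t (p * a + b) (p * c + d))"
  proof (rule sum.cong[OF refl])
    fix c
    show "(\<Sum>j = c * p..<c * p + p. t (p * a + b) j) = (\<Sum>d<p. t (p * a + b) (p * c + d))"
      by (rule sum.reindex_bij_witness[of _ "\<lambda>d. p * c + d" "\<lambda>j. j - p * c"])
         (auto simp: mult.commute)
  qed
  finally have "f (p * a + b) = (\<Sum>c<Suc a. \<Sum>d<p. t (p * a + b) (p * c + d))" .
  moreover have "[(\<Sum>c<Suc a. \<Sum>d<p. t (p * a + b) (p * c + d)) = (\<Sum>c<Suc a. \<Sum>d<p. t a c * t b d)] (mod int p)"
    by (intro cong_sum t) auto
  moreover have "(\<Sum>c<Suc a. \<Sum>d<p. t a c * t b d) = f a * f b"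
    unfolding f_eq[OF lessI[of a]] f_eq[OF b] by (simp only: sum_product)
  ultimately show "[f (p * a + b) = f a * f b] (mod int p)" by simp
qed

theorem theorem4p3:
  fixes a :: nat
  assumes "a \<in> {1, 3}"
  shows "lucas_congruences (A a)"
proof -
  have A_eq: "A a n = (\<Sum>k\<le>n. (- 1) ^ k * int ((n choose k) ^ a) * zbinom (4 * int n - 5 * int k) (3 * n))" for n
    by (simp add: A_def atMost_atLeast0)
  from assms consider (one) "a = 1" | (three) "a = 3" by auto
  then show ?thesis
  proof cases
    case one
    define m :: "nat \<Rightarrow> nat \<Rightarrow> nat" where "m = (\<lambda>n j. if j = 0 then 1 else 0)"
    have m_sum: "(\<Sum>k\<le>n. of_nat ((n choose k) ^ a) * x ^ (n - k) * y ^ k) =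
        (\<Sum>j | 2 * j \<le> n. of_nat (m n j) * (x * y) ^ j * (x + y) ^ (n - 2 * j))" for n and x y :: "rat fps"
    proof -
      have "finite {j. 2 * j \<le> n}" by (rule finite_subset[of _ "{..n}"]) auto
      then have "(\<Sum>j | 2 * j \<le> n. of_nat (m n j) * (x * y) ^ j * (x + y) ^ (n - 2 * j)) =
          (\<Sum>j\<in>{0}. of_nat (m n j) * (x * y) ^ j * (x + y) ^ (n - 2 * j))"
        by (intro sum.mono_neutral_right) (auto simp: m_def)
      also have "\<dots> = (y + x) ^ n" by (simp add: m_def add.commute)
      also have "\<dots> = (\<Sum>k\<le>n. of_nat ((n choose k) ^ a) * x ^ (n - k) * y ^ k)"
        by (subst binomial_ring) (simp add: one mult_ac)
      finally show ?thesis ..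
    qed
    show ?thesis
    proof (rule lucas_congruences_sum_coeff[of _ m])
      show "A a n = (\<Sum>j | 2 * j \<le> n. (- 1) ^ j * int (m n j) * coeff (Q ^ (n - 2 * j)) (n + j))" for n
        unfolding A_eq by (rule sum_zbinom_eq_sum_coeff[OF m_sum])
    \<comment> \<open>For these weights the Lucas condition says that \<open>p * c + d\<close> is 0
      exactly when \<open>c\<close> and \<open>d\<close> both are; and
      \<open>b + d \<ge> p > b\<close> forces \<open>d > 0\<close>, where the weight is 0.\<close>
    qed (auto simp: m_def)
  next
    case three
    show ?thesis
    proof (rule lucas_congruences_sum_coeff[of _ macmahon])
      show "A a n = (\<Sum>j | 2 * j \<le> n. (- 1) ^ j * int (macmahon n j) * coeff (Q ^ (n - 2 * j)) (n + j))" for n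
        unfolding A_eq unfolding three by (rule sum_zbinom_eq_sum_coeff[OF macmahon_identity])
    qed (auto simp: macmahon_lucas macmahon_dvd, auto simp: macmahon_def)
  qed
qed

end
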